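(* Let $G$ be a finite group, let $p$ be the smallest prime dividing $|\mathrm{Aut}(G)|$, and let $g\in G$. If $g\neq 1$ then $$\mathrm{Pr}_g(G,\mathrm{Aut}(G)) \leq \frac{|G|-|L(G)|}{p|G|} < \frac{1}{p}.$$
   Context: For a finite group $G$ with automorphism group $\mathrm{Aut}(G)$, $x\in G$ and $\alpha\in\mathrm{Aut}(G)$, write $[x,\alpha] := x^{-1}\alpha(x)$. Let $L(G) := \{x\in G : [x,\alpha]=1 \text{ for all } \alpha\in\mathrm{Aut}(G)\}$. For $g \in G$, $$\mathrm{Pr}_g(G,\mathrm{Aut}(G)) := \frac{|\{(x,\alpha)\in G\times \mathrm{Aut}(G) : [x,\alpha]=g\}|}{|G||\mathrm{Aut}(G)|}.$$ *)

theory Defs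
  imports "HOL-Algebra.Algebra" "HOL-Computational_Algebra.Primes"
begin

definition autocommutator :: "('a, 'b) monoid_scheme \<Rightarrow> 'a \<Rightarrow> ('a \<Rightarrow> 'a) \<Rightarrow> 'a"
  where "autocommutator G x \<alpha> = inv\<^bsub>G\<^esub> x \<otimes>\<^bsub>G\<^esub> \<alpha> x"

definition absolute_centre :: "('a, 'b) monoid_scheme \<Rightarrow> 'a set"
  where "absolute_centre G =
    {x \<in> carrier G. \<forall>\<alpha> \<in> carrier (AutoGroup G). autocommutator G x \<alpha> = \<one>\<^bsub>G\<^esub>}"

text \<open>Elements of \<^term>\<open>carrier (AutoGroup G)\<close> are extensional functions on \<^term>\<open>carrier G\<close>,
  so each automorphism is counted once.\<close>

definition autocommutator_prob :: "('a, 'b) monoid_scheme \<Rightarrow> 'a \<Rightarrow> real"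
  where "autocommutator_prob G g =
    real (card {(x, \<alpha>) \<in> carrier G \<times> carrier (AutoGroup G). autocommutator G x \<alpha> = g})
      / (real (order G) * real (order (AutoGroup G)))"

end

theory Submission
  imports Defs
begin

text \<open>
  The equation \<open>x\<inverse> \<alpha>(x) = g\<close> says \<open>\<alpha>(x) = x g\<close>, so for a fixed \<open>x\<close> its solutions are the
  automorphisms that transport \<open>x\<close> to one prescribed point. They are either absent or form a coset
  of the stabiliser of \<open>x\<close> (\<open>card_transporter_le\<close>). If \<open>x \<in> L(G)\<close>, then \<open>x\<close> is fixed by every
  automorphism and there is no solution, since \<open>g \<noteq> 1\<close>. If \<open>x \<notin> L(G)\<close>, then the orbit of \<open>x\<close> has
  more than one point, and its length divides \<open>|Aut(G)|\<close> by the orbit-stabiliser theorem. Hence the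
  length is at least \<open>p\<close>, the stabiliser has at most \<open>|Aut(G)| / p\<close> elements
  (\<open>smallest_prime_mult_stabilizer_le\<close>), and so has the set of solutions. Summing over the
  \<open>|G| - |L(G)|\<close> elements outside \<open>L(G)\<close> gives the bound; it is strictly below \<open>1 / p\<close> because
  \<open>1 \<in> L(G)\<close>.
\<close>

lemma prime_lower_bound_le_divisor:
  fixes d n p :: nat
  assumes "\<And>q. Factorial_Ring.prime q \<Longrightarrow> q dvd n \<Longrightarrow> p \<le> q"
    and "d dvd n" and "n > 0" and "d \<noteq> 1"
  shows "p \<le> d"
proof -
  obtain q where q: "Factorial_Ring.prime q" "q dvd d"
    using prime_factor_nat[OF \<open>d \<noteq> 1\<close>] by blast
  have "d > 0" using assms(2,3) by (auto intro: dvd_pos_nat)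
  have "p \<le> q" using assms(1,2) q dvd_trans by blast
  also have "q \<le> d" using q(2) \<open>d > 0\<close> by (rule dvd_imp_le)
  finally show ?thesis .
qed

text \<open>Dividing on the left by one element that moves \<open>x\<close> to \<open>y\<close> embeds the set of all such
  elements into the stabiliser of \<open>x\<close>.\<close>

lemma (in group_action) card_transporter_le:
  assumes "finite (carrier G)" and "x \<in> E"
  shows "card {a \<in> carrier G. \<phi> a x = y} \<le> card (stabilizer G \<phi> x)"
proof (cases "{a \<in> carrier G. \<phi> a x = y} = {}")
  case True
  then show ?thesis by (simp only: card.empty zero_le)
next
  case False
  then obtain b where b: "b \<in> carrier G" "\<phi> b x = y" by blast
  interpret G: group G using group_hom group_hom.axioms(1) by blast
  have "inj_on (\<lambda>a. inv b \<otimes> a) {a \<in> carrier G. \<phi> a x = y}"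
  proof (rule inj_onI)
    fix c d
    assume "c \<in> {a \<in> carrier G. \<phi> a x = y}" "d \<in> {a \<in> carrier G. \<phi> a x = y}"
      and "inv b \<otimes> c = inv b \<otimes> d"
    then show "c = d" using b(1) by simp
  qed
  moreover have "(\<lambda>a. inv b \<otimes> a) ` {a \<in> carrier G. \<phi> a x = y} \<subseteq> stabilizer G \<phi> x"
  proof (rule image_subsetI)
    fix c assume "c \<in> {a \<in> carrier G. \<phi> a x = y}"
    then have "inv b \<otimes> c \<in> carrier G" "\<phi> (inv b \<otimes> c) x = \<phi> (inv b) y"
      using b(1) composition_rule[OF assms(2)] by auto
    then show "inv b \<otimes> c \<in> stabilizer G \<phi> x"
      using orbit_sym_aux[OF b(1) assms(2) b(2)] by (simp add: stabilizer_def)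
  qed
  moreover have "finite (stabilizer G \<phi> x)"
    using stabilizer_subset assms(1) finite_subset by blast
  ultimately show ?thesis by (rule card_inj_on_le)
qed

text \<open>As \<open>a\<close> moves \<open>x\<close>, the orbit of \<open>x\<close> has a length other than 1; this length is the index of
  the stabiliser, so it has a prime factor that divides the group order.\<close>

lemma (in group_action) smallest_prime_mult_stabilizer_le:
  fixes p :: nat
  assumes "finite (carrier G)" and "x \<in> E"
    and least: "\<And>q. Factorial_Ring.prime q \<Longrightarrow> q dvd order G \<Longrightarrow> p \<le> q"
    and moved: "a \<in> carrier G" "\<phi> a x \<noteq> x"
  shows "p * card (stabilizer G \<phi> x) \<le> order G"
proof -
  interpret G: group G using group_hom group_hom.axioms(1) by blast
  have os: "card (orbit G \<phi> x) * card (stabilizer G \<phi> x) = order G"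
    using assms(2) by (rule orbit_stabilizer_theorem)
  have "x \<in> orbit G \<phi> x" using assms(2) by (rule orbit_refl)
  moreover have "\<phi> a x \<in> orbit G \<phi> x" using moved(1) by (auto simp: orbit_def)
  ultimately have "card (orbit G \<phi> x) \<noteq> 1"
    using moved(2) by (metis card_1_singletonE singletonD)
  moreover have "order G > 0" using assms(1) G.order_gt_0_iff_finite by blast
  moreover have "card (orbit G \<phi> x) dvd order G" using os dvd_triv_left by metis
  ultimately have "p \<le> card (orbit G \<phi> x)"
    using least prime_lower_bound_le_divisor by blast
  then show ?thesis using os mult_le_mono1 by metis
qed

lemma (in group) AutoGroup_action: "group_action (AutoGroup G) (carrier G) (\<lambda>\<alpha>. \<alpha>)"
proof -
  have "(\<lambda>\<alpha>. \<alpha>) \<in> hom (AutoGroup G) (BijGroup (carrier G))"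
    by (auto simp: hom_def AutoGroup_def BijGroup_def auto_def)
  then show ?thesis
    by (simp add: group_action_def group_hom_def group_hom_axioms_def AutoGroup group_BijGroup)
qed

lemma AutoGroup_apply_closed:
  assumes "\<alpha> \<in> carrier (AutoGroup G)" and "x \<in> carrier G"
  shows "\<alpha> x \<in> carrier G"
  using assms by (auto simp: AutoGroup_def auto_def hom_def)

text \<open>An automorphism is extensional, so it is determined by its values on \<open>carrier G\<close>.\<close>

lemma finite_carrier_AutoGroup:
  assumes "finite (carrier G)"
  shows "finite (carrier (AutoGroup G))"
proof (rule finite_subset)
  show "carrier (AutoGroup G) \<subseteq> carrier G \<rightarrow>\<^sub>E carrier G"
    by (auto simp: AutoGroup_def auto_def hom_def Bij_def PiE_def)
  show "finite (carrier G \<rightarrow>\<^sub>E carrier G)"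
    using assms by (simp add: finite_PiE)
qed

lemma (in group) autocommutator_eq_iff:
  assumes "x \<in> carrier G" and "\<alpha> \<in> carrier (AutoGroup G)" and "g \<in> carrier G"
  shows "autocommutator G x \<alpha> = g \<longleftrightarrow> \<alpha> x = x \<otimes> g"
  using assms AutoGroup_apply_closed[of \<alpha> G x] inv_solve_left[of g x "\<alpha> x"]
  unfolding autocommutator_def by metis

lemma (in group) one_in_absolute_centre: "\<one> \<in> absolute_centre G"
proof -
  have "autocommutator G \<one> \<alpha> = \<one>" if "\<alpha> \<in> carrier (AutoGroup G)" for \<alpha>
  proof -
    have "\<alpha> \<one> = \<one>"
      using that hom_one[of \<alpha> G G] is_group by (simp add: AutoGroup_def auto_def)
    then show ?thesis by (simp add: autocommutator_def)
  qed
  then show ?thesis by (simp add: absolute_centre_def)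
qed

lemma (in group) absolute_centre_fixed:
  assumes "x \<in> carrier G"
  shows "x \<in> absolute_centre G \<longleftrightarrow> (\<forall>\<alpha> \<in> carrier (AutoGroup G). \<alpha> x = x)"
  using assms autocommutator_eq_iff by (simp add: absolute_centre_def)

text \<open>The count is split into fibres over the first coordinate. Fibres over the absolute centre are
  empty because \<open>g \<noteq> \<one>\<close>; a fibre over any other \<open>x\<close> is the set of automorphisms that send \<open>x\<close>
  to \<open>x \<otimes> g\<close>, which is no larger than the stabiliser of \<open>x\<close>.\<close>

lemma (in group) smallest_prime_mult_card_autocommutator_le:
  fixes p :: nat
  assumes fin: "finite (carrier G)"
    and least: "\<And>q. Factorial_Ring.prime q \<Longrightarrow> q dvd order (AutoGroup G) \<Longrightarrow> p \<le> q"
    and g: "g \<in> carrier G" "g \<noteq> \<one>"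
  shows "p * card {(x, \<alpha>) \<in> carrier G \<times> carrier (AutoGroup G). autocommutator G x \<alpha> = g}
    \<le> card (carrier G - absolute_centre G) * order (AutoGroup G)"
proof -
  interpret A: group_action "AutoGroup G" "carrier G" "\<lambda>\<alpha>. \<alpha>" by (rule AutoGroup_action)
  define F where "F x = {\<alpha> \<in> carrier (AutoGroup G). autocommutator G x \<alpha> = g}" for x
  have finA: "finite (carrier (AutoGroup G))" using fin by (rule finite_carrier_AutoGroup)
  have finF: "finite (F x)" for x using finA by (simp add: F_def)
  have "F x = {}" if "x \<in> absolute_centre G" for x
    using that g(2) by (auto simp: F_def absolute_centre_def)
  then have "{(x, \<alpha>) \<in> carrier G \<times> carrier (AutoGroup G). autocommutator G x \<alpha> = g}
      = Sigma (carrier G - absolute_centre G) F"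
    by (auto simp: F_def)
  then have "p * card {(x, \<alpha>) \<in> carrier G \<times> carrier (AutoGroup G). autocommutator G x \<alpha> = g}
      = (\<Sum>x\<in>carrier G - absolute_centre G. p * card (F x))"
    using fin finF by (simp add: card_SigmaI sum_distrib_left)
  also have "\<dots> \<le> card (carrier G - absolute_centre G) * order (AutoGroup G)"
  proof (rule sum_bounded_above[where 'a = nat, simplified])
    fix x assume x: "x \<in> carrier G - absolute_centre G"
    then obtain \<alpha> where \<alpha>: "\<alpha> \<in> carrier (AutoGroup G)" "\<alpha> x \<noteq> x"
      using absolute_centre_fixed by blast
    have "F x = {\<alpha> \<in> carrier (AutoGroup G). \<alpha> x = x \<otimes> g}"
      using x g(1) autocommutator_eq_iff by (auto simp: F_def)
    then have "card (F x) \<le> card (stabilizer (AutoGroup G) (\<lambda>\<alpha>. \<alpha>) x)"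
      using A.card_transporter_le[OF finA] x by simp
    then have "p * card (F x) \<le> p * card (stabilizer (AutoGroup G) (\<lambda>\<alpha>. \<alpha>) x)"
      by simp
    also have "\<dots> \<le> order (AutoGroup G)"
      using A.smallest_prime_mult_stabilizer_le[OF finA _ least \<alpha>] x by blast
    finally show "p * card (F x) \<le> order (AutoGroup G)" .
  qed
  finally show ?thesis .
qed

theorem proposition3p3:
  fixes G :: "('a, 'b) monoid_scheme" and g :: 'a and p :: nat
  assumes "group G" and "finite (carrier G)"
    and "Factorial_Ring.prime p" and "p dvd order (AutoGroup G)"
    and "\<And>q :: nat. Factorial_Ring.prime q \<Longrightarrow> q dvd order (AutoGroup G) \<Longrightarrow> p \<le> q"
    and "g \<in> carrier G" and "g \<noteq> \<one>\<^bsub>G\<^esub>"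
  shows "autocommutator_prob G g
           \<le> (real (order G) - real (card (absolute_centre G))) / (real p * real (order G))
       \<and> (real (order G) - real (card (absolute_centre G))) / (real p * real (order G)) < 1 / real p"
proof -
  interpret group G by fact
  let ?S = "{(x, \<alpha>) \<in> carrier G \<times> carrier (AutoGroup G). autocommutator G x \<alpha> = g}"
  let ?d = "real (order G) - real (card (absolute_centre G))"
  have p: "real p > 0" using assms(3) by (simp add: prime_gt_0_nat)
  have n: "real (order G) > 0" using assms(2) order_gt_0_iff_finite by simp
  have a: "real (order (AutoGroup G)) > 0"
    using finite_carrier_AutoGroup[OF assms(2)]
      monoid.order_gt_0_iff_finite[OF group.is_monoid[OF AutoGroup]] by simp
  have L: "absolute_centre G \<subseteq> carrier G" by (auto simp: absolute_centre_def)
  have finL: "finite (absolute_centre G)" using L assms(2) finite_subset by blast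
  have d: "real (card (carrier G - absolute_centre G)) = ?d"
    using L finL assms(2) by (simp add: card_Diff_subset order_def of_nat_diff card_mono)
  have "p * card ?S \<le> card (carrier G - absolute_centre G) * order (AutoGroup G)"
    using smallest_prime_mult_card_autocommutator_le assms(2,5-7) by blast
  then have "real p * real (card ?S) \<le> ?d * real (order (AutoGroup G))"
    unfolding d[symmetric] of_nat_mult[symmetric] of_nat_le_iff .
  then have "autocommutator_prob G g \<le> ?d / (real p * real (order G))"
    using p n a unfolding autocommutator_prob_def by (simp add: field_simps)
  moreover have "card (absolute_centre G) > 0"
    using one_in_absolute_centre finL card_gt_0_iff by blast
  then have "?d / (real p * real (order G)) < 1 / real p"
    using p n by (simp add: field_simps)
  ultimately show ?thesis ..
qed

end
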